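(* Let $\{M^n\}_{n\ge1}$, $M^n=(F^n,W^n,\alpha^n)$, be a sequence of balanced random assignment markets, i.e. $|F^n|=|W^n|=n$, where the entries of $\alpha^n$ are i.i.d. with cdf $G$ supported on $[0,1]$ having a density $g$ that is continuous and strictly positive on $[0,1]$. Then, with probability $1-O\left(\frac1n\right)$, under the firm-optimal core allocation of $M^n$ the workers' share of the surplus is $O\left(\frac{\log^2 (n)}{n}\right)$.
   Context: A market is $M^n=(F^n,W^n,\alpha^n)$, where $F^n$ is a finite set of firms, $W^n$ a finite set of workers, and $\alpha^n$ is an $|F^n|\times|W^n|$ real matrix; $\alpha^n_{f,w}$ is the value produced by the pair $(f,w)$. The value of a coalition $S\subseteq F^n\cup W^n$ is $\mathrm{v}(S)=\max[\alpha^n_{i_1j_1}+\dots+\alpha^n_{i_lj_l}]$, the maximum over all choices of $2l$ distinct agents $i_1,\dots,i_l\in S\cap F^n$, $j_1,\dots,j_l\in S\cap W^n$, $l\le\min\{|S\cap F^n|,|S\cap W^n|\}$. An allocation is a triple $(\mu,u,v)$, where $\mu$ is a (one-to-one, possibly partial) matching of firms and workers, and $u=(u_f)_{f\in F^n}$ (profits) and $v=(v_w)_{w\in W^n}$ (salaries) are real payoff vectors. Utility is linear in money and transfers between any agents are allowed, so feasibility means $\sum_f u_f+\sum_w v_w=\sum_{f:\mu(f)\ne\emptyset}\alpha^n_{f,\mu(f)}$. It is a core allocation if no coalition can deviate and split its value so that all its members become strictly better off, i.e. $\sum_{f\in S\cap F^n}u_f+\sum_{w\in S\cap W^n}v_w\ge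 \mathrm{v}(S)$ for every coalition $S$. (Equivalently: $u,v\ge0$, $u_f+v_w\ge\alpha^n_{f,w}$ for all $f,w$, with equality for matched pairs, and unmatched agents get $0$.) It is a known fact (Shapley–Shubik) that there is a firm-optimal core allocation, in which every firm's profit is the largest, and every worker's salary the smallest, among all core allocations; its payoff vectors are unique. The workers' share of the surplus is $\sum_w v_w/\mathrm{v}(F^n\cup W^n)$, the sum of the workers' salaries divided by the total surplus. The $O(\cdot)$'s are as $n\to\infty$, with implied constants independent of $n$ (and non-random). *)

theory Defs
  imports "HOL-Probability.Probability" "HOL-Library.Landau_Symbols"
begin

text \<open>
  A market is given by disjoint finite sets \<open>F\<close> (firms) and \<open>W\<close> (workers) of agents and a
  value matrix \<open>\<alpha>\<close>, where only the entries \<open>\<alpha> f w\<close> with \<open>f \<in> F\<close> and \<open>w \<in> W\<close> matter.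
\<close>

text \<open>
  The two lists enumerate the agents \<open>i\<^sub>1, \<dots>, i\<^sub>l\<close> and \<open>j\<^sub>1, \<dots>, j\<^sub>l\<close>.  The case \<open>l = 0\<close> is
  allowed, so a coalition consisting of firms only (or of workers only) has value \<open>0\<close>.
\<close>
definition coalition_value ::
  "'i set \<Rightarrow> 'i set \<Rightarrow> ('i \<Rightarrow> 'i \<Rightarrow> real) \<Rightarrow> 'i set \<Rightarrow> real" where
  "coalition_value F W \<alpha> S =
     Max {sum_list (map2 \<alpha> is js) | is js.
            length is = length js \<and> distinct is \<and> distinct js \<and>
            set is \<subseteq> S \<inter> F \<and> set js \<subseteq> S \<inter> W}"

definition matching :: "'i set \<Rightarrow> 'i set \<Rightarrow> ('i \<rightharpoonup> 'i) \<Rightarrow> bool" where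
  "matching F W \<mu> \<longleftrightarrow> dom \<mu> \<subseteq> F \<and> ran \<mu> \<subseteq> W \<and> inj_on \<mu> (dom \<mu>)"

definition allocation ::
  "'i set \<Rightarrow> 'i set \<Rightarrow> ('i \<Rightarrow> 'i \<Rightarrow> real) \<Rightarrow> ('i \<rightharpoonup> 'i) \<Rightarrow> ('i \<Rightarrow> real) \<Rightarrow> ('i \<Rightarrow> real) \<Rightarrow> bool" where
  "allocation F W \<alpha> \<mu> u v \<longleftrightarrow>
     matching F W \<mu> \<and>
     (\<Sum>f\<in>F. u f) + (\<Sum>w\<in>W. v w) = (\<Sum>f\<in>dom \<mu>. \<alpha> f (the (\<mu> f)))"

definition core_allocation ::
  "'i set \<Rightarrow> 'i set \<Rightarrow> ('i \<Rightarrow> 'i \<Rightarrow> real) \<Rightarrow> ('i \<rightharpoonup> 'i) \<Rightarrow> ('i \<Rightarrow> real) \<Rightarrow> ('i \<Rightarrow> real) \<Rightarrow> bool" where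
  "core_allocation F W \<alpha> \<mu> u v \<longleftrightarrow>
     allocation F W \<alpha> \<mu> u v \<and>
     (\<forall>S. S \<subseteq> F \<union> W \<longrightarrow>
        (\<Sum>f\<in>S \<inter> F. u f) + (\<Sum>w\<in>S \<inter> W. v w) \<ge> coalition_value F W \<alpha> S)"

definition firm_optimal_core_allocation ::
  "'i set \<Rightarrow> 'i set \<Rightarrow> ('i \<Rightarrow> 'i \<Rightarrow> real) \<Rightarrow> ('i \<rightharpoonup> 'i) \<Rightarrow> ('i \<Rightarrow> real) \<Rightarrow> ('i \<Rightarrow> real) \<Rightarrow> bool" where
  "firm_optimal_core_allocation F W \<alpha> \<mu> u v \<longleftrightarrow>
     core_allocation F W \<alpha> \<mu> u v \<and>
     (\<forall>\<mu>' u' v'. core_allocation F W \<alpha> \<mu>' u' v' \<longrightarrow>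
        (\<forall>f\<in>F. u' f \<le> u f) \<and> (\<forall>w\<in>W. v w \<le> v' w))"

definition workers_share ::
  "'i set \<Rightarrow> 'i set \<Rightarrow> ('i \<Rightarrow> 'i \<Rightarrow> real) \<Rightarrow> ('i \<Rightarrow> real) \<Rightarrow> real" where
  "workers_share F W \<alpha> v = (\<Sum>w\<in>W. v w) / coalition_value F W \<alpha> (F \<union> W)"

text \<open>
  The matching of a firm-optimal core allocation need not be unique, but its payoffs are; hence
  so is the workers' share under it.
\<close>
lemma firm_optimal_payoffs_unique:
  assumes "firm_optimal_core_allocation F W \<alpha> \<mu> u v"
    and "firm_optimal_core_allocation F W \<alpha> \<mu>' u' v'"
  shows "\<And>f. f \<in> F \<Longrightarrow> u f = u' f" and "\<And>w. w \<in> W \<Longrightarrow> v w = v' w"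
  using assms unfolding firm_optimal_core_allocation_def by (meson order_antisym)+

lemma workers_share_unique:
  assumes "firm_optimal_core_allocation F W \<alpha> \<mu> u v"
    and "firm_optimal_core_allocation F W \<alpha> \<mu>' u' v'"
  shows "workers_share F W \<alpha> v = workers_share F W \<alpha> v'"
  unfolding workers_share_def using firm_optimal_payoffs_unique(2)[OF assms] by simp

end

theory Submission
  imports Defs "HOL-Combinatorics.Cycles" "HOL-Real_Asymp.Real_Asymp"
begin

text \<open>
  Fix a perfect matching \<open>m\<close> of maximal value.  Moving the partner of a worker \<open>w\<close> to a worker \<open>w'\<close>
  gains a certain amount, and by optimality of \<open>m\<close> no cycle of such moves has positive gain.  The
  firm-optimal salary of \<open>w\<close> is therefore the largest gain of a path ending in \<open>w\<close>, and some worker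
  earns \<open>0\<close>.  Call a pair heavy if its value is at least \<open>1 - \<delta>\<close>, where \<open>\<delta>\<close> is of order \<open>ln n / n\<close>.
  By a union bound, with probability at least \<open>1 - 2 / n\<close> every set of at most \<open>n / 3\<close> agents on one
  side has at least twice as many heavy partners on the other.  Alternating the matching with heavy
  pairs, any two workers are then connected in \<open>O(ln n)\<close> steps, each of which changes the salary by
  at most \<open>\<delta>\<close>.  Hence every salary is \<open>O(ln\<^sup>2 n / n)\<close>, while every firm earns at least \<open>1 / 2\<close>.
\<close>

section \<open>Maximal path weights as potentials\<close>

fun path_weight :: "('b \<Rightarrow> 'b \<Rightarrow> real) \<Rightarrow> 'b list \<Rightarrow> real" where
  "path_weight c (x # y # zs) = c x y + path_weight c (y # zs)"
| "path_weight c _ = 0"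

text \<open>Only simple paths are considered, so the maximum ranges over a finite set.\<close>
definition potential :: "('b \<Rightarrow> 'b \<Rightarrow> real) \<Rightarrow> 'b set \<Rightarrow> 'b \<Rightarrow> real" where
  "potential c W w =
     Max (path_weight c ` {xs. distinct xs \<and> set xs \<subseteq> W \<and> xs \<noteq> [] \<and> last xs = w})"

lemma path_weight_append:
  "path_weight c (xs @ x # ys) = path_weight c (xs @ [x]) + path_weight c (x # ys)"
proof (induction xs)
  case (Cons a xs) then show ?case by (cases xs) simp_all
qed simp

lemma path_weight_snoc:
  assumes "xs \<noteq> []"
  shows "path_weight c (xs @ [y]) = path_weight c xs + c (last xs) y"
proof -
  obtain ys z where "xs = ys @ [z]" using assms by (cases xs rule: rev_cases) auto
  then show ?thesis using path_weight_append[of c ys z "[y]"] by simp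
qed

text \<open>Telescoping: each edge weighs at most the increase of \<open>v\<close> along it.\<close>

lemma path_weight_le_potential_difference:
  assumes "\<And>x y. x \<in> W \<Longrightarrow> y \<in> W \<Longrightarrow> v x + c x y \<le> v y" "xs \<noteq> []" "set xs \<subseteq> W"
  shows "path_weight c xs \<le> v (last xs) - v (hd xs)"
  using assms(2,3)
proof (induction xs rule: rev_nonempty_induct)
  case (single x) then show ?case by simp
next
  case (snoc x xs)
  then show ?case using assms(1)[of "last xs" x] by (auto simp: path_weight_snoc subset_iff)
qed

text \<open>Pairing every vertex with its successor is the form in which a closed path can be read
  as the graph of a cyclic permutation.\<close>

lemma path_weight_closed:
  "path_weight c (xs @ [y]) = (\<Sum>(a, b)\<leftarrow>zip xs (tl xs @ [y]). c a b)"
proof (induction xs)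
  case (Cons a xs) then show ?case by (cases xs) simp_all
qed simp

lemma finite_paths:
  "finite W \<Longrightarrow> finite {xs. distinct xs \<and> set xs \<subseteq> W \<and> xs \<noteq> [] \<and> last xs = w}"
  by (rule finite_subset[OF _ finite_subset_distinct[of W]]) auto

lemma path_weight_le_potential:
  assumes "finite W" "distinct xs" "set xs \<subseteq> W" "xs \<noteq> []"
  shows "path_weight c xs \<le> potential c W (last xs)"
  unfolding potential_def using assms by (intro Max_ge finite_imageI finite_paths) auto

lemma potential_nonneg: "finite W \<Longrightarrow> w \<in> W \<Longrightarrow> 0 \<le> potential c W w"
  using path_weight_le_potential[of W "[w]" c] by simp

lemma potential_path:
  assumes "finite W" "w \<in> W"
  obtains xs where "distinct xs" "set xs \<subseteq> W" "xs \<noteq> []" "last xs = w"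
    "potential c W w = path_weight c xs"
proof -
  have "potential c W w \<in> path_weight c ` {xs. distinct xs \<and> set xs \<subseteq> W \<and> xs \<noteq> [] \<and> last xs = w}"
    unfolding potential_def
  proof (rule Max_in)
    have "[w] \<in> {xs. distinct xs \<and> set xs \<subseteq> W \<and> xs \<noteq> [] \<and> last xs = w}" using assms by simp
    then show "path_weight c ` {xs. distinct xs \<and> set xs \<subseteq> W \<and> xs \<noteq> [] \<and> last xs = w} \<noteq> {}"
      by blast
  qed (intro finite_imageI finite_paths assms)
  then show thesis using that by blast
qed

text \<open>The potential is attained by some path; its weight telescopes to at most
  \<open>v w\<close> minus the value of \<open>v\<close> at the start, which is nonnegative. Applied
  to the salaries of an arbitrary core allocation, this makes the potential the firm-optimal
  choice.\<close>

lemma potential_least: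
  assumes "finite W" "\<And>x y. x \<in> W \<Longrightarrow> y \<in> W \<Longrightarrow> v x + c x y \<le> v y" "\<And>x. x \<in> W \<Longrightarrow> 0 \<le> v x"
    and "w \<in> W"
  shows "potential c W w \<le> v w"
proof -
  obtain xs where xs: "distinct xs" "set xs \<subseteq> W" "xs \<noteq> []" "last xs = w"
    "potential c W w = path_weight c xs" by (rule potential_path[OF assms(1,4)])
  have "path_weight c xs \<le> v (last xs) - v (hd xs)"
    using path_weight_le_potential_difference[of W v c xs] assms xs by blast
  moreover have "0 \<le> v (hd xs)" using assms xs by (meson hd_in_set subsetD)
  ultimately show ?thesis using xs by simp
qed

text \<open>The condition on cycles is phrased with permutations of all of \<open>W\<close>, because
  comparing an optimal matching with its rearrangements gives exactly this. Vertices off the cycle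
  are fixed points and cost nothing by \<open>refl\<close>.\<close>

locale no_positive_cycle =
  fixes c :: "'b \<Rightarrow> 'b \<Rightarrow> real" and W :: "'b set"
  assumes W: "finite W" and refl: "\<And>x. x \<in> W \<Longrightarrow> c x x = 0"
    and perm: "\<And>p. p permutes W \<Longrightarrow> (\<Sum>x\<in>W. c x (p x)) \<le> 0"
begin

text \<open>A closed path is the nontrivial part of the permutation \<^const>\<open>cycle_of_list\<close>.\<close>
lemma closed_path_weight_nonpos:
  assumes xs: "distinct xs" "set xs \<subseteq> W" "xs \<noteq> []"
  shows "path_weight c (xs @ [hd xs]) \<le> 0"
proof -
  let ?p = "cycle_of_list xs"
  have p: "?p permutes set xs" using cycle_permutes .
  have rot: "map ?p xs = tl xs @ [hd xs]"
    using cyclic_rotation[of xs 1] xs by (cases xs) auto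
  have "path_weight c (xs @ [hd xs]) = (\<Sum>(a, b)\<leftarrow>zip xs (map ?p xs). c a b)"
    by (simp add: path_weight_closed rot)
  also have "\<dots> = (\<Sum>x\<leftarrow>xs. c x (?p x))"
    by (simp add: zip_map2 zip_same_conv_map comp_def)
  also have "\<dots> = (\<Sum>x\<in>set xs. c x (?p x))" using xs by (simp add: sum_list_distinct_conv_sum_set)
  also have "\<dots> = (\<Sum>x\<in>W. c x (?p x))"
    using W xs p refl by (intro sum.mono_neutral_left) (auto simp: permutes_def subset_iff)
  also have "\<dots> \<le> 0" using perm permutes_subset[OF p] xs by blast
  finally show ?thesis .
qed

lemma potential_step:
  assumes xy: "x \<in> W" "y \<in> W"
  shows "potential c W x + c x y \<le> potential c W y"
proof -
  obtain xs where xs: "distinct xs" "set xs \<subseteq> W" "xs \<noteq> []" "last xs = x"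
    "potential c W x = path_weight c xs" by (rule potential_path[OF W xy(1)])
  have eq: "potential c W x + c x y = path_weight c (xs @ [y])"
    using xs by (simp add: path_weight_snoc)
  show ?thesis
  proof (cases "y \<in> set xs")
    case False
    then show ?thesis using path_weight_le_potential[of W "xs @ [y]" c] xs W xy eq by simp
  next
    case True
    then obtain ys zs where s: "xs = ys @ y # zs" by (meson split_list)
    \<comment> \<open>cut off the closed walk from \<open>y\<close> back to \<open>y\<close>, which has nonpositive weight\<close>
    have "path_weight c (xs @ [y]) = path_weight c (ys @ [y]) + path_weight c ((y # zs) @ [y])"
      using path_weight_append[of c ys y "zs @ [y]"] s by simp
    moreover have "path_weight c ((y # zs) @ [y]) \<le> 0"
      using closed_path_weight_nonpos[of "y # zs"] xs s by auto
    moreover have "path_weight c (ys @ [y]) \<le> potential c W y"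
      using path_weight_le_potential[of W "ys @ [y]" c] xs s W by auto
    ultimately show ?thesis using eq by linarith
  qed
qed

text \<open>Returning from \<open>w\<close> to the start of a best path closes a cycle, so the path
  gains no more than the return edge loses. This later keeps a salary below the value of the matched
  pair, hence profits nonnegative.\<close>

lemma potential_le_closing:
  assumes w: "w \<in> W" and b: "\<And>x. x \<in> W \<Longrightarrow> - b \<le> c w x"
  shows "potential c W w \<le> b"
proof -
  obtain xs where xs: "distinct xs" "set xs \<subseteq> W" "xs \<noteq> []" "last xs = w"
    "potential c W w = path_weight c xs" by (rule potential_path[OF W w])
  have "path_weight c xs + c w (hd xs) \<le> 0"
    using closed_path_weight_nonpos[OF xs(1-3)] xs by (simp add: path_weight_snoc)
  moreover have "- b \<le> c w (hd xs)" using b xs by (meson hd_in_set subsetD)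
  ultimately show ?thesis using xs by simp
qed

text \<open>Subtracting the minimum \<open>d\<close> preserves the step inequalities and
  nonnegativity, so leastness of the potential forces \<open>d \<le> 0\<close>.\<close>

lemma potential_eq_0:
  assumes "W \<noteq> {}"
  shows "\<exists>w\<in>W. potential c W w = 0"
proof -
  define d where "d = Min (potential c W ` W)"
  have d: "d \<le> potential c W x" if "x \<in> W" for x using that W by (simp add: d_def W)
  have "d \<in> potential c W ` W" unfolding d_def using W assms by (intro Min_in) auto
  then obtain w where w: "w \<in> W" "potential c W w = d" by blast
  have "potential c W w \<le> potential c W w - d"
    using potential_least[of W "\<lambda>x. potential c W x - d" c w]
      potential_step d w W by force
  then have "d \<le> 0" by simp
  then show ?thesis using w potential_nonneg[of W w c] W by force
qed

end

section \<open>Firm-optimal core allocations\<close>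

text \<open>The constraints of the linear program dual to maximum-weight bipartite matching.\<close>

definition dual_feasible ::
  "'i set \<Rightarrow> 'i set \<Rightarrow> ('i \<Rightarrow> 'i \<Rightarrow> real) \<Rightarrow> ('i \<Rightarrow> real) \<Rightarrow> ('i \<Rightarrow> real) \<Rightarrow> bool" where
  "dual_feasible F W \<alpha> u v \<longleftrightarrow> (\<forall>f\<in>F. 0 \<le> u f) \<and> (\<forall>w\<in>W. 0 \<le> v w) \<and>
     (\<forall>f\<in>F. \<forall>w\<in>W. \<alpha> f w \<le> u f + v w)"

text \<open>
  Negative values count as \<open>0\<close>, since such a pair would stay unmatched.  Values are negative with
  probability \<open>0\<close> only, but the event in the theorem has to be measurable on the whole sample space.
\<close>
definition matching_value :: "'i set \<Rightarrow> ('i \<Rightarrow> 'i \<Rightarrow> real) \<Rightarrow> ('i \<Rightarrow> 'i) \<Rightarrow> real" where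
  "matching_value F \<alpha> m = (\<Sum>f\<in>F. max 0 (\<alpha> f (m f)))"

text \<open>With negative values truncated and equally many agents on both sides, a partial matching
  extends to a perfect one without loss, so bijections suffice.\<close>

definition optimal_matching ::
  "'i set \<Rightarrow> 'i set \<Rightarrow> ('i \<Rightarrow> 'i \<Rightarrow> real) \<Rightarrow> ('i \<Rightarrow> 'i) \<Rightarrow> bool" where
  "optimal_matching F W \<alpha> m \<longleftrightarrow> bij_betw m F W \<and>
     (\<forall>m'. bij_betw m' F W \<longrightarrow> matching_value F \<alpha> m' \<le> matching_value F \<alpha> m)"

text \<open>The edge weights of the exchange graph of \<open>m\<close>: the employer of
  \<open>w\<close> goes over to \<open>w'\<close>.\<close>

definition rematch_gain ::
  "'i set \<Rightarrow> ('i \<Rightarrow> 'i \<Rightarrow> real) \<Rightarrow> ('i \<Rightarrow> 'i) \<Rightarrow> 'i \<Rightarrow> 'i \<Rightarrow> real" where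
  "rematch_gain F \<alpha> m w w' =
     max 0 (\<alpha> (the_inv_into F m w) w') - max 0 (\<alpha> (the_inv_into F m w) w)"

definition salary :: "'i set \<Rightarrow> 'i set \<Rightarrow> ('i \<Rightarrow> 'i \<Rightarrow> real) \<Rightarrow> ('i \<Rightarrow> 'i) \<Rightarrow> 'i \<Rightarrow> real" where
  "salary F W \<alpha> m = potential (rematch_gain F \<alpha> m) W"

section \<open>Coalition values, linear duality and the core\<close>

lemma finite_coalition_sums:
  assumes "finite F" "finite W"
  shows "finite {sum_list (map2 \<alpha> is js) | is js. length is = length js \<and> distinct is \<and>
    distinct js \<and> set is \<subseteq> S \<inter> F \<and> set js \<subseteq> S \<inter> W}"
proof (rule finite_subset)
  show "{sum_list (map2 \<alpha> is js) | is js. length is = length js \<and> distinct is \<and>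
    distinct js \<and> set is \<subseteq> S \<inter> F \<and> set js \<subseteq> S \<inter> W} \<subseteq>
    (\<lambda>(is, js). sum_list (map2 \<alpha> is js)) `
      ({is. distinct is \<and> set is \<subseteq> F} \<times> {js. distinct js \<and> set js \<subseteq> W})" by auto
  have "finite {is. distinct is \<and> set is \<subseteq> F}" "finite {js. distinct js \<and> set js \<subseteq> W}"
    using finite_subset_distinct[OF assms(1)] finite_subset_distinct[OF assms(2)]
    by (simp_all add: conj_commute)
  then show "finite ((\<lambda>(is, js). sum_list (map2 \<alpha> is js)) `
      ({is. distinct is \<and> set is \<subseteq> F} \<times> {js. distinct js \<and> set js \<subseteq> W}))" by (intro finite_imageI finite_cartesian_product)
qed

lemma coalition_value_ge:
  assumes "finite F" "finite W" "length is = length js" "distinct is" "distinct js"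
    "set is \<subseteq> S \<inter> F" "set js \<subseteq> S \<inter> W"
  shows "sum_list (map2 \<alpha> is js) \<le> coalition_value F W \<alpha> S"
  unfolding coalition_value_def
  by (rule Max_ge[OF finite_coalition_sums[OF assms(1,2)]], rule CollectI,
      rule exI[of _ "is"], rule exI[of _ js]) (use assms(3-) in simp)

lemma coalition_value_le:
  assumes "finite F" "finite W"
    "\<And>is js. length is = length js \<Longrightarrow> distinct is \<Longrightarrow> distinct js \<Longrightarrow>
      set is \<subseteq> S \<inter> F \<Longrightarrow> set js \<subseteq> S \<inter> W \<Longrightarrow> sum_list (map2 \<alpha> is js) \<le> b"
  shows "coalition_value F W \<alpha> S \<le> b"
  unfolding coalition_value_def
proof (rule Max.boundedI)
  have "length [] = length [] \<and> distinct [] \<and> distinct [] \<and> set [] \<subseteq> S \<inter> F \<and> set [] \<subseteq> S \<inter> W"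
    by simp
  then show "{sum_list (map2 \<alpha> is js) | is js. length is = length js \<and> distinct is \<and>
    distinct js \<and> set is \<subseteq> S \<inter> F \<and> set js \<subseteq> S \<inter> W} \<noteq> {}" by blast
next
  show "\<And>x. x \<in> {sum_list (map2 \<alpha> is js) | is js. length is = length js \<and> distinct is \<and>
    distinct js \<and> set is \<subseteq> S \<inter> F \<and> set js \<subseteq> S \<inter> W} \<Longrightarrow> x \<le> b" using assms(3) by blast
qed (rule finite_coalition_sums[OF assms(1,2)])

text \<open>Weak duality: add up the constraints of the chosen pairs; the agents left over
  contribute nonnegative payoffs.\<close>

lemma coalition_value_le_dual:
  assumes fin: "finite F" "finite W" and d: "dual_feasible F W \<alpha> u v"
  shows "coalition_value F W \<alpha> S \<le> (\<Sum>f\<in>S \<inter> F. u f) + (\<Sum>w\<in>S \<inter> W. v w)"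
proof (rule coalition_value_le[OF fin])
  fix "is" js assume l: "length is = length js" "distinct is" "distinct js"
    "set is \<subseteq> S \<inter> F" "set js \<subseteq> S \<inter> W"
  have "sum_list (map2 \<alpha> is js) \<le> sum_list (map u is) + sum_list (map v js)"
    using l(1,4,5)
  proof (induction "is" js rule: list_induct2)
    case (Cons x xs y ys)
    then have "\<alpha> x y \<le> u x + v y" using d by (auto simp: dual_feasible_def)
    then show ?case using Cons by simp
  qed simp
  also have "\<dots> = sum u (set is) + sum v (set js)"
    using l by (simp add: sum_list_distinct_conv_sum_set)
  also have "\<dots> \<le> sum u (S \<inter> F) + sum v (S \<inter> W)"
    using l fin d by (intro add_mono sum_mono2) (auto simp: dual_feasible_def)
  finally show "sum_list (map2 \<alpha> is js) \<le> sum u (S \<inter> F) + sum v (S \<inter> W)" .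
qed

lemma sum_matched_le_coalition_value:
  assumes fin: "finite F" "finite W" and h: "D \<subseteq> F" "inj_on h D" "h ` D \<subseteq> W"
  shows "(\<Sum>f\<in>D. \<alpha> f (h f)) \<le> coalition_value F W \<alpha> (F \<union> W)"
proof -
  obtain xs where xs: "set xs = D" "distinct xs"
    using finite_distinct_list finite_subset[OF h(1) fin(1)] by blast
  have "(\<Sum>f\<in>D. \<alpha> f (h f)) = sum_list (map (\<lambda>f. \<alpha> f (h f)) xs)"
    using xs sum_list_distinct_conv_sum_set[of xs "\<lambda>f. \<alpha> f (h f)"] by simp
  also have "map (\<lambda>f. \<alpha> f (h f)) xs = map2 \<alpha> xs (map h xs)"
    by (simp add: zip_map2 zip_same_conv_map comp_def)
  also have "sum_list \<dots> \<le> coalition_value F W \<alpha> (F \<union> W)"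
    using xs h by (intro coalition_value_ge fin) (auto simp: distinct_map)
  finally show ?thesis .
qed

text \<open>One-agent coalitions, worth at least the empty sum, give nonnegativity, and coalitions
  of a firm and a worker give the pair constraints. The total payoff is the value of the matching
  \<open>\<mu>\<close>, one of the candidates for the grand coalition.\<close>

lemma core_allocation_dual_feasible:
  assumes fin: "finite F" "finite W" "F \<inter> W = {}" and core: "core_allocation F W \<alpha> \<mu> u v"
  shows "dual_feasible F W \<alpha> u v"
    and "(\<Sum>f\<in>F. u f) + (\<Sum>w\<in>W. v w) \<le> coalition_value F W \<alpha> (F \<union> W)"
proof -
  have cv: "sum_list (map2 \<alpha> is js) \<le> sum u (S \<inter> F) + sum v (S \<inter> W)"
    if "S \<subseteq> F \<union> W" "length is = length js" "distinct is" "distinct js"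
      "set is \<subseteq> S \<inter> F" "set js \<subseteq> S \<inter> W" for S "is" js
    using coalition_value_ge[OF fin(1,2) that(2-), of \<alpha>] core that(1)
    unfolding core_allocation_def by (meson order_trans)
  show "dual_feasible F W \<alpha> u v"
    unfolding dual_feasible_def
  proof (intro conjI ballI)
    fix f assume f: "f \<in> F"
    then have "{f} \<inter> F = {f}" "{f} \<inter> W = {}" using fin(3) by auto
    then show "0 \<le> u f" using cv[of "{f}" "[]" "[]"] f by simp
  next
    fix w assume w: "w \<in> W"
    then have "{w} \<inter> W = {w}" "{w} \<inter> F = {}" using fin(3) by auto
    then show "0 \<le> v w" using cv[of "{w}" "[]" "[]"] w by simp
  next
    fix f w assume fw: "f \<in> F" "w \<in> W"
    then have eq: "{f, w} \<inter> F = {f}" "{f, w} \<inter> W = {w}" using fin(3) by auto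
    show "\<alpha> f w \<le> u f + v w" using cv[of "{f, w}" "[f]" "[w]", unfolded eq] fw by simp
  qed
  have m: "matching F W \<mu>"
    and eq: "sum u F + sum v W = (\<Sum>f\<in>dom \<mu>. \<alpha> f (the (\<mu> f)))"
    using core by (auto simp: core_allocation_def allocation_def)
  have "inj_on (\<lambda>f. the (\<mu> f)) (dom \<mu>)"
    using m by (auto simp: matching_def inj_on_def dom_def)
  moreover have "(\<lambda>f. the (\<mu> f)) ` dom \<mu> \<subseteq> W"
    using m by (auto simp: matching_def ran_def)
  ultimately show "sum u F + sum v W \<le> coalition_value F W \<alpha> (F \<union> W)"
    unfolding eq using m by (intro sum_matched_le_coalition_value fin) (auto simp: matching_def)
qed

text \<open>Leaving pairs of nonpositive value unmatched makes the true value of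
  \<open>\<mu>\<close> equal to the truncated value of \<open>m\<close>. Weak duality then excludes
  every deviating coalition.\<close>

lemma dual_feasible_core_allocation:
  assumes fin: "finite F" "finite W" and d: "dual_feasible F W \<alpha> u v"
    and m: "inj_on m F" "m ` F \<subseteq> W"
    and eq: "sum u F + sum v W = matching_value F \<alpha> m"
  shows "\<exists>\<mu>. core_allocation F W \<alpha> \<mu> u v"
proof
  define \<mu> where "\<mu> = (\<lambda>f. if f \<in> F \<and> 0 < \<alpha> f (m f) then Some (m f) else None)"
  have dom: "dom \<mu> = {f \<in> F. 0 < \<alpha> f (m f)}" by (auto simp: \<mu>_def dom_def)
  have "matching F W \<mu>"
    using m by (auto simp: matching_def dom ran_def inj_on_def \<mu>_def split: if_splits)
  moreover have "(\<Sum>f\<in>dom \<mu>. \<alpha> f (the (\<mu> f))) = (\<Sum>f\<in>dom \<mu>. max 0 (\<alpha> f (m f)))"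
    by (rule sum.cong) (auto simp: dom \<mu>_def)
  moreover have "\<dots> = matching_value F \<alpha> m"
    unfolding matching_value_def using fin by (intro sum.mono_neutral_left) (auto simp: dom)
  ultimately show "core_allocation F W \<alpha> \<mu> u v"
    using eq coalition_value_le_dual[OF fin d] by (auto simp: core_allocation_def allocation_def)
qed

section \<open>Firm-optimal payoffs from an optimal matching\<close>

locale assignment_market =
  fixes F W :: "'i set" and \<alpha> :: "'i \<Rightarrow> 'i \<Rightarrow> real"
  assumes finF: "finite F" and finW: "finite W" and disj: "F \<inter> W = {}"
begin

text \<open>Permuting the workers by \<open>p\<close> produces the perfect matching
  \<open>p \<circ> m\<close>, and the total gain is the difference of the two matching
  values.\<close>

lemma no_positive_cycle_rematch_gain:
  assumes "optimal_matching F W \<alpha> m"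
  shows "no_positive_cycle (rematch_gain F \<alpha> m) W"
proof
  have m: "bij_betw m F W" using assms by (simp add: optimal_matching_def)
  fix p assume p: "p permutes W"
  have "(\<Sum>w\<in>W. rematch_gain F \<alpha> m w (p w)) = (\<Sum>f\<in>F. rematch_gain F \<alpha> m (m f) (p (m f)))"
    by (rule sum.reindex_bij_betw[OF m, symmetric])
  also have "\<dots> = matching_value F \<alpha> (p \<circ> m) - matching_value F \<alpha> m"
    using m by (simp add: rematch_gain_def the_inv_into_f_f bij_betw_def matching_value_def sum_subtractf)
  also have "\<dots> \<le> 0"
    using assms bij_betw_trans[OF m permutes_imp_bij[OF p]] by (simp add: optimal_matching_def)
  finally show "(\<Sum>w\<in>W. rematch_gain F \<alpha> m w (p w)) \<le> 0" .
qed (auto simp: finW rematch_gain_def)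

lemma
  assumes opt: "optimal_matching F W \<alpha> m"
  shows salary_nonneg: "w \<in> W \<Longrightarrow> 0 \<le> salary F W \<alpha> m w"
    and salary_le: "f \<in> F \<Longrightarrow> salary F W \<alpha> m (m f) \<le> max 0 (\<alpha> f (m f))"
    and salary_step: "f \<in> F \<Longrightarrow> w \<in> W \<Longrightarrow>
      salary F W \<alpha> m (m f) + max 0 (\<alpha> f w) - max 0 (\<alpha> f (m f)) \<le> salary F W \<alpha> m w"
    and salary_eq_0: "W \<noteq> {} \<Longrightarrow> \<exists>w\<in>W. salary F W \<alpha> m w = 0"
proof -
  interpret no_positive_cycle "rematch_gain F \<alpha> m" W
    by (rule no_positive_cycle_rematch_gain[OF opt])
  have inv: "the_inv_into F m (m f) = f" if "f \<in> F" for f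
    using opt that by (simp add: optimal_matching_def bij_betw_def the_inv_into_f_f)
  have mW: "m f \<in> W" if "f \<in> F" for f
    using opt that by (auto simp: optimal_matching_def bij_betw_def)
  show "w \<in> W \<Longrightarrow> 0 \<le> salary F W \<alpha> m w"
    unfolding salary_def by (rule potential_nonneg[OF finW])
  show "W \<noteq> {} \<Longrightarrow> \<exists>w\<in>W. salary F W \<alpha> m w = 0"
    unfolding salary_def by (rule potential_eq_0)
  \<comment> \<open>Leaving \<open>m f\<close> costs the firm \<open>f\<close> at most the truncated
    value of that pair, which therefore serves as the bound \<open>b\<close> for the return
    edge.\<close>
  show "salary F W \<alpha> m (m f) \<le> max 0 (\<alpha> f (m f))" if "f \<in> F"
    unfolding salary_def
    by (rule potential_le_closing) (use mW inv that in \<open>auto simp: rematch_gain_def\<close>)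
  show "salary F W \<alpha> m (m f) + max 0 (\<alpha> f w) - max 0 (\<alpha> f (m f)) \<le> salary F W \<alpha> m w"
    if "f \<in> F" "w \<in> W"
    unfolding salary_def using potential_step[OF mW[OF that(1)] that(2)]
    by (simp add: rematch_gain_def inv that)
qed

definition profit :: "('i \<Rightarrow> 'i) \<Rightarrow> 'i \<Rightarrow> real" where
  "profit m f = max 0 (\<alpha> f (m f)) - salary F W \<alpha> m (m f)"

lemma dual_feasible_salary:
  assumes "optimal_matching F W \<alpha> m"
  shows "dual_feasible F W \<alpha> (profit m) (salary F W \<alpha> m)"
  unfolding dual_feasible_def profit_def
proof (intro conjI ballI)
  fix f w assume fw: "f \<in> F" "w \<in> W"
  then show "\<alpha> f w \<le> max 0 (\<alpha> f (m f)) - salary F W \<alpha> m (m f) + salary F W \<alpha> m w"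
    using salary_step[OF assms fw] by linarith
qed (use salary_nonneg[OF assms] salary_le[OF assms] in auto)

lemma sum_profit_salary:
  assumes "optimal_matching F W \<alpha> m"
  shows "sum (profit m) F + sum (salary F W \<alpha> m) W = matching_value F \<alpha> m"
proof -
  have "sum (salary F W \<alpha> m) W = (\<Sum>f\<in>F. salary F W \<alpha> m (m f))"
    using assms sum.reindex_bij_betw[of m F W "salary F W \<alpha> m"] by (simp add: optimal_matching_def)
  then show ?thesis by (simp add: profit_def matching_value_def sum_subtractf)
qed

text \<open>The salaries and profits are a dual certificate of the same total, which gives the upper
  bound. The pairs of positive value in \<open>m\<close> give the lower bound.\<close>

lemma coalition_value_eq_matching_value:
  assumes opt: "optimal_matching F W \<alpha> m"
  shows "coalition_value F W \<alpha> (F \<union> W) = matching_value F \<alpha> m"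
proof (rule antisym)
  have "(F \<union> W) \<inter> F = F" "(F \<union> W) \<inter> W = W" by auto
  then show "coalition_value F W \<alpha> (F \<union> W) \<le> matching_value F \<alpha> m"
    using coalition_value_le_dual[OF finF finW dual_feasible_salary[OF opt], of "F \<union> W"]
      sum_profit_salary[OF opt] by simp
  let ?D = "{f \<in> F. 0 < \<alpha> f (m f)}"
  have m: "inj_on m F" "m ` F = W" using opt by (auto simp: optimal_matching_def bij_betw_def)
  have "matching_value F \<alpha> m = (\<Sum>f\<in>?D. max 0 (\<alpha> f (m f)))"
    unfolding matching_value_def using finF by (intro sum.mono_neutral_right) auto
  also have "\<dots> = (\<Sum>f\<in>?D. \<alpha> f (m f))" by (rule sum.cong) auto
  also have "\<dots> \<le> coalition_value F W \<alpha> (F \<union> W)"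
    using m by (intro sum_matched_le_coalition_value finF finW) (auto simp: inj_on_def)
  finally show "matching_value F \<alpha> m \<le> coalition_value F W \<alpha> (F \<union> W)" .
qed

text \<open>Complementary slackness: the slacks of the matched pairs are nonnegative and their sum
  is at most 0.\<close>

lemma dual_optimal_tight:
  assumes opt: "optimal_matching F W \<alpha> m" and d: "dual_feasible F W \<alpha> u v"
    and le: "sum u F + sum v W \<le> matching_value F \<alpha> m" and f: "f \<in> F"
  shows "u f + v (m f) = max 0 (\<alpha> f (m f))"
proof -
  have m: "bij_betw m F W" using opt by (simp add: optimal_matching_def)
  have nonneg: "0 \<le> u f + v (m f) - max 0 (\<alpha> f (m f))" if "f \<in> F" for f
    using d bij_betwE[OF m] that by (auto simp: dual_feasible_def)
  have "(\<Sum>f\<in>F. u f + v (m f) - max 0 (\<alpha> f (m f))) = sum u F + sum v W - matching_value F \<alpha> m"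
    using sum.reindex_bij_betw[OF m, of v]
    by (simp add: matching_value_def sum_subtractf sum.distrib)
  then have "(\<Sum>f\<in>F. u f + v (m f) - max 0 (\<alpha> f (m f))) = 0"
    using le sum_nonneg[of F "\<lambda>f. u f + v (m f) - max 0 (\<alpha> f (m f))"] nonneg by simp
  then show ?thesis using nonneg f finF by (simp add: sum_nonneg_eq_0_iff)
qed

text \<open>Tightness at the employer of \<open>x\<close> and feasibility of that firm with
  \<open>y\<close> combine into the step inequality of \<open>potential_least\<close>.\<close>

lemma salary_least:
  assumes opt: "optimal_matching F W \<alpha> m" and d: "dual_feasible F W \<alpha> u v"
    and le: "sum u F + sum v W \<le> matching_value F \<alpha> m" and w: "w \<in> W"
  shows "salary F W \<alpha> m w \<le> v w"
  unfolding salary_def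
proof (rule potential_least[OF finW _ _ w])
  fix x y assume xy: "x \<in> W" "y \<in> W"
  have m: "bij_betw m F W" using opt by (simp add: optimal_matching_def)
  let ?f = "the_inv_into F m x"
  have f: "?f \<in> F" "m ?f = x"
    using m xy by (auto simp: bij_betw_def intro: the_inv_into_into f_the_inv_into_f)
  have "u ?f + v x = max 0 (\<alpha> ?f x)" using dual_optimal_tight[OF opt d le f(1)] f by simp
  moreover have "max 0 (\<alpha> ?f y) \<le> u ?f + v y"
    using d f xy by (auto simp: dual_feasible_def)
  ultimately show "v x + rematch_gain F \<alpha> m x y \<le> v y" by (simp add: rematch_gain_def max_def split: if_splits)
qed (use d in \<open>auto simp: dual_feasible_def\<close>)

lemma firm_optimal_salary:
  assumes opt: "optimal_matching F W \<alpha> m"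
  shows "\<exists>\<mu>. firm_optimal_core_allocation F W \<alpha> \<mu> (profit m) (salary F W \<alpha> m)"
proof -
  have m: "bij_betw m F W" using opt by (simp add: optimal_matching_def)
  obtain \<mu> where \<mu>: "core_allocation F W \<alpha> \<mu> (profit m) (salary F W \<alpha> m)"
    using dual_feasible_core_allocation[OF finF finW dual_feasible_salary[OF opt] _ _
        sum_profit_salary[OF opt]] m by (auto simp: bij_betw_def)
  have "(\<forall>f\<in>F. u f \<le> profit m f) \<and> (\<forall>w\<in>W. salary F W \<alpha> m w \<le> v w)"
    if "core_allocation F W \<alpha> \<mu>' u v" for \<mu>' u v
  proof -
    have d: "dual_feasible F W \<alpha> u v" "sum u F + sum v W \<le> matching_value F \<alpha> m"
      using core_allocation_dual_feasible[OF finF finW disj that]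
      by (simp_all add: coalition_value_eq_matching_value[OF opt])
    have least: "salary F W \<alpha> m w \<le> v w" if "w \<in> W" for w
      using salary_least[OF opt d that] .
    \<comment> \<open>Employer and worker share a fixed amount in every core allocation, so the
      least salary leaves the largest profit.\<close>
    have "u f \<le> profit m f" if "f \<in> F" for f
      using dual_optimal_tight[OF opt d that] least[of "m f"] bij_betwE[OF m] that
      by (simp add: profit_def)
    then show ?thesis using least by blast
  qed
  then show ?thesis using \<mu> by (auto simp: firm_optimal_core_allocation_def)
qed

text \<open>Uniqueness of the payoffs replaces the quantifiers by an explicit function of the
  values. Both measurability and the probability bound rest on this form.\<close>

lemma exists_firm_optimal_workers_share_le_iff:
  assumes opt: "optimal_matching F W \<alpha> m"
  shows "(\<exists>\<mu> u v. firm_optimal_core_allocation F W \<alpha> \<mu> u v \<and> workers_share F W \<alpha> v \<le> x) \<longleftrightarrow>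
    sum (salary F W \<alpha> m) W / matching_value F \<alpha> m \<le> x"
proof -
  obtain \<mu> where \<mu>: "firm_optimal_core_allocation F W \<alpha> \<mu> (profit m) (salary F W \<alpha> m)"
    using firm_optimal_salary[OF opt] by blast
  have "workers_share F W \<alpha> (salary F W \<alpha> m) = sum (salary F W \<alpha> m) W / matching_value F \<alpha> m"
    by (simp add: workers_share_def coalition_value_eq_matching_value[OF opt])
  then have eq: "workers_share F W \<alpha> v = sum (salary F W \<alpha> m) W / matching_value F \<alpha> m"
    if "firm_optimal_core_allocation F W \<alpha> \<mu>' u v" for \<mu>' u v
    using workers_share_unique[OF that \<mu>] by simp
  show ?thesis using eq \<mu> by fastforce
qed

end

text \<open>Extensional functions, so that each matching occurs once and the set is finite.\<close>

definition perfect_matchings :: "'i set \<Rightarrow> 'i set \<Rightarrow> ('i \<Rightarrow> 'i) set" where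
  "perfect_matchings F W = {m \<in> F \<rightarrow>\<^sub>E W. bij_betw m F W}"

lemma finite_perfect_matchings: "finite F \<Longrightarrow> finite W \<Longrightarrow> finite (perfect_matchings F W)"
  unfolding perfect_matchings_def by (simp add: finite_PiE)

lemma restrict_perfect_matching:
  assumes "bij_betw m F W"
  shows "restrict m F \<in> perfect_matchings F W"
    and "matching_value F \<alpha> (restrict m F) = matching_value F \<alpha> m"
proof -
  have "bij_betw (restrict m F) F W \<longleftrightarrow> bij_betw m F W" by (rule bij_betw_cong) simp
  then show "restrict m F \<in> perfect_matchings F W"
    using assms by (auto simp: perfect_matchings_def dest: bij_betwE)
  show "matching_value F \<alpha> (restrict m F) = matching_value F \<alpha> m"
    unfolding matching_value_def by (rule sum.cong) auto
qed

text \<open>Restriction to \<open>F\<close> does not change the value. Optimality thus becomes a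
  finite conjunction, as measurability requires.\<close>

lemma optimal_matching_iff:
  assumes "m \<in> perfect_matchings F W"
  shows "optimal_matching F W \<alpha> m \<longleftrightarrow>
    (\<forall>m'\<in>perfect_matchings F W. matching_value F \<alpha> m' \<le> matching_value F \<alpha> m)"
proof
  assume "\<forall>m'\<in>perfect_matchings F W. matching_value F \<alpha> m' \<le> matching_value F \<alpha> m"
  then have "matching_value F \<alpha> m' \<le> matching_value F \<alpha> m" if "bij_betw m' F W" for m'
    using restrict_perfect_matching(1)[OF that] restrict_perfect_matching(2)[OF that, of \<alpha>]
    by metis
  then show "optimal_matching F W \<alpha> m"
    using assms by (simp add: optimal_matching_def perfect_matchings_def)
qed (simp add: optimal_matching_def perfect_matchings_def)

lemma exists_optimal_matching:
  assumes "finite F" "finite W" "card F = card W"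
  shows "\<exists>m\<in>perfect_matchings F W. optimal_matching F W \<alpha> m"
proof -
  let ?P = "perfect_matchings F W"
  obtain m where "bij_betw m F W" using finite_same_card_bij[OF assms] by blast
  then have ne: "?P \<noteq> {}" using restrict_perfect_matching(1) by blast
  have fin: "finite (matching_value F \<alpha> ` ?P)"
    using assms by (intro finite_imageI finite_perfect_matchings)
  have "Max (matching_value F \<alpha> ` ?P) \<in> matching_value F \<alpha> ` ?P"
    using fin ne by (intro Max_in) auto
  then obtain m' where m': "m' \<in> ?P" "Max (matching_value F \<alpha> ` ?P) = matching_value F \<alpha> m'" by blast
  have "matching_value F \<alpha> x \<le> matching_value F \<alpha> m'" if "x \<in> ?P" for x
    using Max_ge[OF fin imageI[OF that]] m' by simp
  then show ?thesis using m' optimal_matching_iff[OF m'(1)] by blast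
qed

section \<open>Expansion\<close>

text \<open>Sets of up to a third of the agents can double and still fit. Doubling a third covers
  about two thirds, more than half of the other side, and two such sets must meet.\<close>

definition expanding :: "'b set \<Rightarrow> 'c set \<Rightarrow> ('b \<Rightarrow> 'c \<Rightarrow> bool) \<Rightarrow> bool" where
  "expanding U V E \<longleftrightarrow> (\<forall>A\<subseteq>U. A \<noteq> {} \<and> 3 * card A \<le> card U \<longrightarrow>
     2 * card A \<le> card {v \<in> V. \<exists>x\<in>A. E x v})"

text \<open>A set beyond the cutoff is replaced by a subset of size \<open>card U div 3\<close>,
  nonempty because \<open>3 \<le> card U\<close>.\<close>

lemma expanding_card:
  assumes "finite U" "finite V" "expanding U V E" "A \<subseteq> U" "3 \<le> card U"
  shows "2 * min (card A) (card U div 3) \<le> card {v \<in> V. \<exists>x\<in>A. E x v}"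
proof (cases "A = {}")
  case False
  define k where "k = min (card A) (card U div 3)"
  obtain B where B: "B \<subseteq> A" "card B = k" "finite B"
    using obtain_subset_with_card_n[of k A] by (metis k_def min.cobounded1)
  have "0 < k" using False assms finite_subset[OF assms(4)] by (auto simp: k_def card_gt_0_iff)
  then have "B \<noteq> {}" "3 * card B \<le> card U" using B by (auto simp: k_def)
  then have "2 * card B \<le> card {v \<in> V. \<exists>x\<in>B. E x v}"
    using assms(3,4) B(1) unfolding expanding_def by (meson order_trans)
  also have "\<dots> \<le> card {v \<in> V. \<exists>x\<in>A. E x v}"
    using assms(2) B(1) by (intro card_mono) auto
  finally show ?thesis using B by (simp add: k_def)
qed simp

text \<open>Below \<open>t\<close> the sequence at least doubles; from \<open>t\<close> on, every
  further term is at least \<open>2 * t\<close>.\<close>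

lemma doubling_sequence_ge:
  fixes s :: "nat \<Rightarrow> nat"
  assumes "1 \<le> s 0" "\<And>k. 2 * min (s k) t \<le> s (Suc k)"
  shows "min (2 ^ k) (2 * t) \<le> s k"
proof (induction k)
  case (Suc k)
  then show ?case using assms(2)[of k] by (auto simp: min_def split: if_splits)
qed (use assms(1) in auto)

text \<open>
  The sets \<open>S k\<close> of workers paid at least \<open>v w1 - k * \<delta>\<close> and \<open>T k\<close> of workers paid at most
  \<open>v w0 + k * \<delta>\<close> double with \<open>k\<close> until they contain more than half of the workers, so \<open>S L\<close> and \<open>T L\<close>
  meet.
\<close>
lemma payoff_gap_le:
  fixes u :: "'b \<Rightarrow> real" and v :: "'c \<Rightarrow> real"
  assumes fin: "finite F" "finite W" and card: "card F = n" "card W = n" and n: "9 \<le> n"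
    and m: "bij_betw m F W" and tight: "\<And>f. f \<in> F \<Longrightarrow> u f + v (m f) \<le> 1"
    and E: "\<And>f w. f \<in> F \<Longrightarrow> w \<in> W \<Longrightarrow> E f w \<Longrightarrow> 1 - \<delta> \<le> u f + v w"
    and exp: "expanding F W E" "expanding W F (\<lambda>w f. E f w)"
    and L: "n \<le> 2 ^ L" and ww: "w1 \<in> W" "w0 \<in> W"
  shows "v w1 \<le> v w0 + 2 * real L * \<delta>"
proof -
  define S where "S k = {w \<in> W. v w1 - real k * \<delta> \<le> v w}" for k
  define T where "T k = {w \<in> W. v w \<le> v w0 + real k * \<delta>}" for k
  have mW: "m f \<in> W" if "f \<in> F" for f using m that by (auto simp: bij_betw_def)
  have inj: "inj_on m F" and img: "m ` F = W" using m by (auto simp: bij_betw_def)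
  have fS: "finite (S k)" and fT: "finite (T k)" for k using fin by (auto simp: S_def T_def)
  have "2 * min (card (S k)) (n div 3) \<le> card (S (Suc k))" for k
  proof -
    let ?A = "{f \<in> F. m f \<in> S k}"
    have "m ` ?A = S k" using img by (auto simp: S_def)
    then have "card ?A = card (S k)"
      by (metis (no_types, lifting) card_image inj inj_on_subset mem_Collect_eq subsetI)
    moreover have "2 * min (card ?A) (n div 3) \<le> card {w \<in> W. \<exists>f\<in>?A. E f w}"
      using expanding_card[OF fin exp(1), of ?A] card n by auto
    moreover have "{w \<in> W. \<exists>f\<in>?A. E f w} \<subseteq> S (Suc k)"
    proof
      fix w assume "w \<in> {w \<in> W. \<exists>f\<in>?A. E f w}"
      then obtain f where "w \<in> W" "f \<in> F" "m f \<in> S k" "E f w" by auto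
      \<comment> \<open>Tightness gives \<open>u f \<le> 1 - v (m f)\<close>, and the edge then
        gives \<open>v w \<ge> v (m f) - \<delta>\<close>.\<close>
      then show "w \<in> S (Suc k)"
        using tight[of f] E[of f w] by (auto simp: S_def algebra_simps)
    qed
    ultimately show ?thesis
      using card_mono[OF fS, of "{w \<in> W. \<exists>f\<in>?A. E f w}" "Suc k"] by linarith
  qed
  moreover have "1 \<le> card (S 0)"
    using ww fS[of 0] by (simp add: Suc_le_eq card_gt_0_iff) (auto simp: S_def)
  ultimately have SL: "min (2 ^ L) (2 * (n div 3)) \<le> card (S L)"
    by (intro doubling_sequence_ge) auto
  have "2 * min (card (T k)) (n div 3) \<le> card (T (Suc k))" for k
  proof -
    let ?B = "{f \<in> F. \<exists>w\<in>T k. E f w}"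
    have "2 * min (card (T k)) (n div 3) \<le> card ?B"
      using expanding_card[OF fin(2,1) exp(2), of "T k"] card n by (auto simp: T_def)
    also have "card ?B = card (m ` ?B)"
      using inj by (metis (no_types, lifting) card_image inj_on_subset mem_Collect_eq subsetI)
    also have "\<dots> \<le> card (T (Suc k))"
    proof (rule card_mono[OF fT], rule subsetI)
      fix w' assume "w' \<in> m ` ?B"
      then obtain f w where "w' = m f" "w \<in> T k" "f \<in> F" "E f w" by auto
      \<comment> \<open>Here the edge is used first, \<open>u f \<ge> 1 - \<delta> - v w\<close>,
        and then the matching, \<open>v (m f) \<le> 1 - u f\<close>.\<close>
      then show "w' \<in> T (Suc k)"
        using tight[of f] E[of f w] mW[of f] by (auto simp: T_def algebra_simps)
    qed
    finally show ?thesis .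
  qed
  moreover have "1 \<le> card (T 0)"
    using ww fT[of 0] by (simp add: Suc_le_eq card_gt_0_iff) (auto simp: T_def)
  ultimately have TL: "min (2 ^ L) (2 * (n div 3)) \<le> card (T L)"
    by (intro doubling_sequence_ge) auto
  \<comment> \<open>Two sets of size \<open>2 * (n div 3)\<close> exceed \<open>n\<close> together
    once \<open>n \<ge> 9\<close>; for \<open>n = 8\<close> the inequality fails.\<close>
  have "n < 4 * (n div 3)" using n by presburger
  then have "n < card (S L) + card (T L)" using SL TL L by (auto simp: min_def split: if_splits)
  moreover have "card (S L \<union> T L) \<le> n"
    using card_mono[OF fin(2), of "S L \<union> T L"] card by (auto simp: S_def T_def)
  ultimately have "S L \<inter> T L \<noteq> {}"
    using card_Un_disjoint[OF fS fT, of L L] by force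
  then obtain w where "w \<in> S L" "w \<in> T L" by blast
  then show ?thesis by (auto simp: S_def T_def algebra_simps)
qed

context assignment_market
begin

text \<open>Some salary is 0, so the gap bound limits every salary to
  \<open>2 * real L * \<delta>\<close>. With each profit at least 1/2, the total is at least
  \<open>n / 2\<close>, and dividing doubles the constant.\<close>

lemma expanding_imp_workers_share_le:
  assumes card: "card F = n" "card W = n" and n: "9 \<le> n"
    and le1: "\<And>f w. f \<in> F \<Longrightarrow> w \<in> W \<Longrightarrow> \<alpha> f w \<le> 1"
    and exp: "expanding F W (\<lambda>f w. 1 - \<delta> \<le> \<alpha> f w)"
      "expanding W F (\<lambda>w f. 1 - \<delta> \<le> \<alpha> f w)"
    and L: "n \<le> 2 ^ L" and \<delta>: "0 \<le> \<delta>" "(2 * real L + 1) * \<delta> \<le> 1 / 2"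
    and opt: "optimal_matching F W \<alpha> m"
  shows "sum (salary F W \<alpha> m) W / matching_value F \<alpha> m \<le> 4 * real L * \<delta>"
proof -
  let ?v = "salary F W \<alpha> m" and ?u = "profit m"
  have m: "bij_betw m F W" using opt by (simp add: optimal_matching_def)
  have d: "dual_feasible F W \<alpha> ?u ?v" using dual_feasible_salary[OF opt] .
  have "W \<noteq> {}" "F \<noteq> {}" using card n by auto
  then obtain w0 where w0: "w0 \<in> W" "?v w0 = 0" using salary_eq_0[OF opt] by blast
  have v: "?v w \<le> 2 * real L * \<delta>" if "w \<in> W" for w
  proof -
    have "?v w \<le> ?v w0 + 2 * real L * \<delta>"
    proof (rule payoff_gap_le[OF finF finW card n m _ _ exp L that w0(1)])
      show "?u f + ?v (m f) \<le> 1" if "f \<in> F" for f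
        using le1[OF that] bij_betwE[OF m] that by (simp add: profit_def)
      show "1 - \<delta> \<le> ?u f + ?v w" if "f \<in> F" "w \<in> W" "1 - \<delta> \<le> \<alpha> f w" for f w
        using d that by (force simp: dual_feasible_def)
    qed
    then show ?thesis using w0 by simp
  qed
  have u: "1 / 2 \<le> ?u f" if f: "f \<in> F" for f
  proof -
    \<comment> \<open>Expansion of a single firm already supplies a heavy partner \<open>w\<close>.
      The profit is then at least \<open>1 - \<delta> - 2 * real L * \<delta>\<close>, which the
      bound on \<open>(2 * real L + 1) * \<delta>\<close> keeps above 1/2.\<close>
    have "2 * card {f} \<le> card {w \<in> W. \<exists>x\<in>{f}. 1 - \<delta> \<le> \<alpha> x w}"
      using exp(1) f card n unfolding expanding_def
      by (elim allE[of _ "{f}"]) auto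
    then have "0 < card {w \<in> W. 1 - \<delta> \<le> \<alpha> f w}" by simp
    then have "{w \<in> W. 1 - \<delta> \<le> \<alpha> f w} \<noteq> {}" by (rule card_gt_0_iff[THEN iffD1, THEN conjunct1])
    then obtain w where w: "w \<in> W" "1 - \<delta> \<le> \<alpha> f w" by blast
    then have "1 - \<delta> \<le> ?u f + ?v w" using d f by (force simp: dual_feasible_def)
    then show ?thesis using v[OF w(1)] \<delta> by (simp add: algebra_simps)
  qed
  have nonneg: "0 \<le> sum ?v W" using salary_nonneg[OF opt] by (simp add: sum_nonneg)
  have "real n * (1 / 2) \<le> sum ?u F"
    using sum_bounded_below[of F "1 / 2" ?u] u card by simp
  then have V: "real n / 2 \<le> matching_value F \<alpha> m"
    using nonneg sum_profit_salary[OF opt] by simp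
  have S: "sum ?v W \<le> real n * (2 * real L * \<delta>)"
    using sum_bounded_above[of W ?v "2 * real L * \<delta>"] v card by simp
  have "sum ?v W / matching_value F \<alpha> m \<le> real n * (2 * real L * \<delta>) / (real n / 2)"
    using S V nonneg n \<delta> by (intro frac_le) auto
  then show ?thesis using n by simp
qed

end

section \<open>Measurability\<close>

lemma borel_measurable_path_weight:
  assumes "\<And>x y. x \<in> W \<Longrightarrow> y \<in> W \<Longrightarrow> (\<lambda>\<omega>. c \<omega> x y) \<in> borel_measurable M" "set xs \<subseteq> W"
  shows "(\<lambda>\<omega>. path_weight (c \<omega>) xs) \<in> borel_measurable M"
  using assms(2)
proof (induction xs)
  case (Cons x xs)
  then show ?case
    by (cases xs) (auto intro!: borel_measurable_add assms(1))
qed simp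

text \<open>The set of simple paths does not depend on \<open>\<omega>\<close>, so this is a maximum
  of a fixed finite family.\<close>

lemma borel_measurable_potential:
  assumes "finite W" "\<And>x y. x \<in> W \<Longrightarrow> y \<in> W \<Longrightarrow> (\<lambda>\<omega>. c \<omega> x y) \<in> borel_measurable M"
  shows "(\<lambda>\<omega>. potential (c \<omega>) W w) \<in> borel_measurable M"
  unfolding potential_def
proof (rule borel_measurable_Max[OF finite_paths[OF assms(1)]])
  fix xs assume "xs \<in> {xs. distinct xs \<and> set xs \<subseteq> W \<and> xs \<noteq> [] \<and> last xs = w}"
  then show "(\<lambda>\<omega>. path_weight (c \<omega>) xs) \<in> borel_measurable M"
    by (intro borel_measurable_path_weight[of W] assms(2)) auto
qed

lemma borel_measurable_matching_value:
  assumes "\<And>f w. f \<in> F \<Longrightarrow> w \<in> W \<Longrightarrow> (\<lambda>\<omega>. \<alpha> \<omega> f w) \<in> borel_measurable M" "bij_betw m F W"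
  shows "(\<lambda>\<omega>. matching_value F (\<alpha> \<omega>) m) \<in> borel_measurable M"
  unfolding matching_value_def using assms bij_betwE[OF assms(2)]
  by (intro borel_measurable_sum borel_measurable_max) auto

lemma borel_measurable_salary:
  assumes "finite W" "\<And>f w. f \<in> F \<Longrightarrow> w \<in> W \<Longrightarrow> (\<lambda>\<omega>. \<alpha> \<omega> f w) \<in> borel_measurable M"
    and m: "bij_betw m F W"
  shows "(\<lambda>\<omega>. salary F W (\<alpha> \<omega>) m w) \<in> borel_measurable M"
  unfolding salary_def
proof (rule borel_measurable_potential[OF assms(1)])
  fix x y assume xy: "x \<in> W" "y \<in> W"
  have "the_inv_into F m x \<in> F"
    using m xy by (auto simp: bij_betw_def intro: the_inv_into_into)
  then show "(\<lambda>\<omega>. rematch_gain F (\<alpha> \<omega>) m x y) \<in> borel_measurable M"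
    unfolding rematch_gain_def
    by (intro borel_measurable_diff borel_measurable_max assms(2) xy) auto
qed

text \<open>The existential over payoff vectors is uncountable. Splitting by which perfect matching
  is optimal turns the event into a finite union of sets given by inequalities between measurable
  functions.\<close>

lemma sets_firm_optimal_share_le:
  assumes fin: "finite F" "finite W" "F \<inter> W = {}" "card F = card W"
    and meas: "\<And>f w. f \<in> F \<Longrightarrow> w \<in> W \<Longrightarrow> (\<lambda>\<omega>. \<alpha> \<omega> f w) \<in> borel_measurable M"
  shows "{\<omega> \<in> space M. \<exists>\<mu> u v. firm_optimal_core_allocation F W (\<alpha> \<omega>) \<mu> u v \<and>
    workers_share F W (\<alpha> \<omega>) v \<le> x} \<in> sets M" (is "?Ev \<in> _")
proof -
  let ?P = "perfect_matchings F W"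
  let ?S = "\<lambda>m. {\<omega> \<in> space M. \<forall>m'\<in>?P. matching_value F (\<alpha> \<omega>) m' \<le> matching_value F (\<alpha> \<omega>) m} \<inter>
    {\<omega> \<in> space M. sum (salary F W (\<alpha> \<omega>) m) W / matching_value F (\<alpha> \<omega>) m \<le> x}"
  have am: "assignment_market F W" using fin by unfold_locales
  have eq: "?Ev = (\<Union>m\<in>?P. ?S m)"
  proof (intro set_eqI iffI)
    fix \<omega> assume \<omega>: "\<omega> \<in> ?Ev"
    obtain m where m: "m \<in> ?P" "optimal_matching F W (\<alpha> \<omega>) m"
      using exists_optimal_matching[OF fin(1,2,4)] by blast
    then have "sum (salary F W (\<alpha> \<omega>) m) W / matching_value F (\<alpha> \<omega>) m \<le> x"
      using \<omega> assignment_market.exists_firm_optimal_workers_share_le_iff[OF am m(2)] by blast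
    then show "\<omega> \<in> (\<Union>m\<in>?P. ?S m)" using m \<omega> optimal_matching_iff[OF m(1)] by blast
  next
    fix \<omega> assume "\<omega> \<in> (\<Union>m\<in>?P. ?S m)"
    then obtain m where m: "m \<in> ?P" "\<omega> \<in> ?S m" by blast
    then have "optimal_matching F W (\<alpha> \<omega>) m" using optimal_matching_iff by blast
    from assignment_market.exists_firm_optimal_workers_share_le_iff[OF am this, of x] m(2)
    show "\<omega> \<in> ?Ev" by simp
  qed
  have "?S m \<in> sets M" if m: "m \<in> ?P" for m
  proof -
    have mv: "(\<lambda>\<omega>. matching_value F (\<alpha> \<omega>) m') \<in> borel_measurable M" if "m' \<in> ?P" for m'
      using that by (intro borel_measurable_matching_value[of F W] meas)
        (auto simp: perfect_matchings_def)
    have "(\<lambda>\<omega>. sum (salary F W (\<alpha> \<omega>) m) W / matching_value F (\<alpha> \<omega>) m) \<in> borel_measurable M"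
      using m by (intro borel_measurable_divide borel_measurable_sum mv borel_measurable_salary
          meas fin) (auto simp: perfect_matchings_def)
    then have "{\<omega> \<in> space M. sum (salary F W (\<alpha> \<omega>) m) W / matching_value F (\<alpha> \<omega>) m \<le> x} \<in> sets M"
      by (intro borel_measurable_le) auto
    moreover have "{\<omega> \<in> space M. \<forall>m'\<in>?P.
        matching_value F (\<alpha> \<omega>) m' \<le> matching_value F (\<alpha> \<omega>) m} \<in> sets M"
      by (intro sets.sets_Collect_finite_All borel_measurable_le mv m finite_perfect_matchings fin)
    ultimately show ?thesis by (rule sets.Int[rotated])
  qed
  then show ?thesis
    unfolding eq using finite_perfect_matchings[OF fin(1,2)] by (intro sets.finite_UN) auto
qed

section \<open>Random markets\<close>

context prob_space
begin

text \<open>By independence the probability is a product over the \<open>card A * card B\<close>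
  pairs.\<close>

lemma prob_all_less_le:
  fixes X :: "'a \<Rightarrow> 'b \<Rightarrow> 'c \<Rightarrow> real"
  assumes indep: "indep_vars (\<lambda>_. borel) (\<lambda>(f, w) \<omega>. X \<omega> f w) (F \<times> W)"
    and AB: "A \<subseteq> F" "B \<subseteq> W" "finite A" "finite B" "A \<noteq> {}" "B \<noteq> {}"
    and q: "\<And>f w. f \<in> F \<Longrightarrow> w \<in> W \<Longrightarrow> prob {\<omega> \<in> space M. X \<omega> f w < t} \<le> q"
  shows "{\<omega> \<in> space M. \<forall>f\<in>A. \<forall>w\<in>B. X \<omega> f w < t} \<in> events"
    and "prob {\<omega> \<in> space M. \<forall>f\<in>A. \<forall>w\<in>B. X \<omega> f w < t} \<le> q ^ (card A * card B)"
proof -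
  let ?Y = "\<lambda>i. (\<lambda>(f, w) \<omega>. X \<omega> f w) i -` {..<t} \<inter> space M"
  have eq: "{\<omega> \<in> space M. \<forall>f\<in>A. \<forall>w\<in>B. X \<omega> f w < t} = (\<Inter>i\<in>A \<times> B. ?Y i)"
    using AB by auto
  have Y: "?Y i = {\<omega> \<in> space M. X \<omega> (fst i) (snd i) < t}" for i by (auto split: prod.splits)
  have rv: "(\<lambda>(f, w) \<omega>. X \<omega> f w) i \<in> borel_measurable M" if "i \<in> F \<times> W" for i
    using indep that unfolding indep_vars_def by blast
  have "?Y i \<in> events" if "i \<in> A \<times> B" for i
    using AB that by (intro measurable_sets[OF rv]) auto
  then show "{\<omega> \<in> space M. \<forall>f\<in>A. \<forall>w\<in>B. X \<omega> f w < t} \<in> events"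
    unfolding eq using AB by (intro sets.finite_INT) auto
  have "prob (\<Inter>i\<in>A \<times> B. ?Y i) = (\<Prod>i\<in>A \<times> B. prob (?Y i))"
    using AB by (intro indep_varsD[OF indep]) auto
  also have "\<dots> \<le> (\<Prod>i\<in>A \<times> B. q)"
  proof (rule prod_mono)
    fix i assume "i \<in> A \<times> B"
    then have "fst i \<in> F" "snd i \<in> W" using AB by auto
    then show "0 \<le> prob (?Y i) \<and> prob (?Y i) \<le> q"
      unfolding Y using q by simp
  qed
  also have "\<dots> = q ^ (card A * card B)" by (simp add: card_cartesian_product)
  finally show "prob {\<omega> \<in> space M. \<forall>f\<in>A. \<forall>w\<in>B. X \<omega> f w < t} \<le> q ^ (card A * card B)"
    unfolding eq .
qed

text \<open>
  If \<open>A\<close> with \<open>k\<close> elements violates expansion, then it has no edge to some \<open>B\<close> with \<open>n + 1 - 2 * k\<close>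
  elements.  There are at most \<open>n ^ (3 * k)\<close> such pairs, each with probability at most
  \<open>1 / n ^ (5 * k)\<close>; the latter is where the constant \<open>15\<close> comes from.
\<close>
lemma prob_not_expanding_le:
  fixes E :: "'a \<Rightarrow> 'b \<Rightarrow> 'c \<Rightarrow> bool"
  assumes fin: "finite U" "finite V" and card: "card U = n" "card V = n" and n: "1 \<le> n"
    and ev: "\<And>A B. A \<subseteq> U \<Longrightarrow> B \<subseteq> V \<Longrightarrow> A \<noteq> {} \<Longrightarrow> B \<noteq> {} \<Longrightarrow>
      {\<omega> \<in> space M. \<forall>x\<in>A. \<forall>y\<in>B. \<not> E \<omega> x y} \<in> events"
    and q: "\<And>A B. A \<subseteq> U \<Longrightarrow> B \<subseteq> V \<Longrightarrow> A \<noteq> {} \<Longrightarrow> B \<noteq> {} \<Longrightarrow>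
      prob {\<omega> \<in> space M. \<forall>x\<in>A. \<forall>y\<in>B. \<not> E \<omega> x y} \<le> exp (- (15 * ln n / n)) ^ (card A * card B)"
  shows "{\<omega> \<in> space M. \<not> expanding U V (E \<omega>)} \<in> events"
    and "prob {\<omega> \<in> space M. \<not> expanding U V (E \<omega>)} \<le> 1 / n"
proof -
  let ?I = "Sigma {1..n div 3} (\<lambda>k. {A. A \<subseteq> U \<and> card A = k} \<times> {B. B \<subseteq> V \<and> card B = n + 1 - 2 * k})"
  let ?N = "\<lambda>(k::nat, A, B). {\<omega> \<in> space M. \<forall>x\<in>A. \<forall>y\<in>B. \<not> E \<omega> x y}"
  have finI: "finite ?I" using fin by auto
  have eq: "{\<omega> \<in> space M. \<not> expanding U V (E \<omega>)} = (\<Union>i\<in>?I. ?N i)"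
  proof (intro set_eqI iffI)
    fix \<omega> assume "\<omega> \<in> {\<omega> \<in> space M. \<not> expanding U V (E \<omega>)}"
    then obtain A where A: "\<omega> \<in> space M" "A \<subseteq> U" "A \<noteq> {}" "3 * card A \<le> n"
      "card {y \<in> V. \<exists>x\<in>A. E \<omega> x y} < 2 * card A"
      using card by (auto simp: expanding_def not_le)
    let ?C = "V - {y \<in> V. \<exists>x\<in>A. E \<omega> x y}"
    have "card ?C = n - card {y \<in> V. \<exists>x\<in>A. E \<omega> x y}"
      using fin card by (subst card_Diff_subset) auto
    \<comment> \<open>At most \<open>2 * card A - 1\<close> neighbours exist; this is where the
      \<open>+ 1\<close> comes from.\<close>
    then have "n + 1 - 2 * card A \<le> card ?C" using A by linarith
    then obtain B where B: "B \<subseteq> ?C" "card B = n + 1 - 2 * card A"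
      by (meson obtain_subset_with_card_n)
    have "finite A" using A fin finite_subset by blast
    then have "0 < card A" using A by (simp add: card_gt_0_iff)
    then have "card A \<in> {1..n div 3}" using A by auto
    then have "(card A, A, B) \<in> ?I" using A B by auto
    moreover have "\<omega> \<in> ?N (card A, A, B)" using A B by auto
    ultimately show "\<omega> \<in> (\<Union>i\<in>?I. ?N i)" by blast
  next
    fix \<omega> assume "\<omega> \<in> (\<Union>i\<in>?I. ?N i)"
    then obtain A B where A: "A \<subseteq> U" "card A \<in> {1..n div 3}" "B \<subseteq> V" "card B = n + 1 - 2 * card A"
      "\<omega> \<in> space M" "\<forall>x\<in>A. \<forall>y\<in>B. \<not> E \<omega> x y" by auto
    have "card {y \<in> V. \<exists>x\<in>A. E \<omega> x y} \<le> card (V - B)"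
      using A fin by (intro card_mono) auto
    also have "\<dots> = n - card B"
      using A fin card by (subst card_Diff_subset) (auto intro: finite_subset)
    finally have "card {y \<in> V. \<exists>x\<in>A. E \<omega> x y} < 2 * card A" using A by auto
    moreover have "A \<noteq> {}" "3 * card A \<le> card U" using A card by auto
    ultimately have "\<not> expanding U V (E \<omega>)" using A(1) by (auto simp: expanding_def not_le)
    then show "\<omega> \<in> {\<omega> \<in> space M. \<not> expanding U V (E \<omega>)}" using A by simp
  qed
  have N: "?N (k, A, B) \<in> events" "prob (?N (k, A, B)) \<le> 1 / real n ^ (5 * k)"
    if "k \<in> {1..n div 3}" "A \<subseteq> U" "card A = k" "B \<subseteq> V" "card B = n + 1 - 2 * k" for k A B
  proof -
    have "card B > 0" using that by auto
    then have ne: "A \<noteq> {}" "B \<noteq> {}" using that by auto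
    then show "?N (k, A, B) \<in> events" using ev[of A B] that by simp
    \<comment> \<open>Since \<open>k \<le> n / 3\<close>, there are at least
      \<open>k * n / 3\<close> pairs, and 15/3 yields the exponent \<open>5 * k\<close>.\<close>
    have "real n / 3 \<le> real (n + 1 - 2 * k)" using that by auto
    then have "real k * (real n / 3) \<le> real k * real (n + 1 - 2 * k)" by (intro mult_left_mono) auto
    then have "15 * ln n / n * (real k * (real n / 3)) \<le> 15 * ln n / n * real (card A * card B)"
      using n that(3,5) by (intro mult_left_mono) auto
    then have *: "- (real (card A * card B) * (15 * ln n / n)) \<le> - (real (5 * k) * ln n)"
      using n by (simp add: field_simps)
    have "prob (?N (k, A, B)) \<le> exp (- (15 * ln n / n)) ^ (card A * card B)"
      using q[of A B] ne that by simp
    also have "\<dots> = exp (- (real (card A * card B) * (15 * ln n / n)))"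
      by (simp add: exp_of_nat_mult[symmetric])
    also have "\<dots> \<le> exp (- (real (5 * k) * ln n))" using * by (simp only: exp_le_cancel_iff)
    also have "\<dots> = 1 / real n ^ (5 * k)"
      using n by (simp only: exp_minus exp_of_nat_mult) (simp add: field_simps)
    finally show "prob (?N (k, A, B)) \<le> 1 / real n ^ (5 * k)" .
  qed
  have sub: "?N ` ?I \<subseteq> events" using N(1) by force
  then show "{\<omega> \<in> space M. \<not> expanding U V (E \<omega>)} \<in> events"
    unfolding eq using finI by (intro sets.finite_UN) auto
  have "prob (\<Union>i\<in>?I. ?N i) \<le> (\<Sum>i\<in>?I. prob (?N i))"
    by (rule finite_measure_subadditive_finite[OF finI sub])
  also have "\<dots> \<le> (\<Sum>(k, _)\<in>?I. 1 / real n ^ (5 * k))"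
    using N(2) by (intro sum_mono) force
  also have "\<dots> = (\<Sum>k\<in>{1..n div 3}.
      \<Sum>_\<in>{A. A \<subseteq> U \<and> card A = k} \<times> {B. B \<subseteq> V \<and> card B = n + 1 - 2 * k}. 1 / real n ^ (5 * k))"
    using fin by (subst sum.Sigma) auto
  \<comment> \<open>As \<open>k \<ge> 1\<close>, each size contributes at most
    \<open>1 / n ^ (2 * k) \<le> 1 / n ^ 2\<close>, and there are at most \<open>n\<close>
    sizes.\<close>
  also have "\<dots> \<le> (\<Sum>k\<in>{1..n div 3}. 1 / real n ^ 2)"
  proof (rule sum_mono)
    fix k assume k: "k \<in> {1..n div 3}"
    have "card ({A. A \<subseteq> U \<and> card A = k} \<times> {B. B \<subseteq> V \<and> card B = n + 1 - 2 * k}) =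
        (n choose k) * (n choose (n + 1 - 2 * k))"
      using fin card by (simp add: card_cartesian_product n_subsets)
    \<comment> \<open>Passing to complements replaces an exponent of order \<open>n\<close> by one
      of order \<open>k\<close>.\<close>
    also have "n choose (n + 1 - 2 * k) = n choose (2 * k - 1)"
      using k by (subst binomial_symmetric) (auto intro!: arg_cong2[where f = binomial])
    also have "(n choose k) * (n choose (2 * k - 1)) \<le> n ^ k * n ^ (2 * k - 1)"
      using k by (intro mult_mono binomial_le_pow) auto
    also have "\<dots> \<le> n ^ k * n ^ (2 * k)"
      using n by (intro mult_mono power_increasing) auto
    also have "\<dots> = n ^ (3 * k)" by (simp flip: power_add)
    finally have "card ({A. A \<subseteq> U \<and> card A = k} \<times> {B. B \<subseteq> V \<and> card B = n + 1 - 2 * k}) \<le>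
        n ^ (3 * k)" .
    from of_nat_mono[OF this, where 'a = real]
    have "real (card ({A. A \<subseteq> U \<and> card A = k} \<times> {B. B \<subseteq> V \<and> card B = n + 1 - 2 * k})) \<le>
        real n ^ (3 * k)" by (simp only: of_nat_power)
    then have "(\<Sum>_\<in>{A. A \<subseteq> U \<and> card A = k} \<times> {B. B \<subseteq> V \<and> card B = n + 1 - 2 * k}.
        1 / real n ^ (5 * k)) \<le> real n ^ (3 * k) * (1 / real n ^ (5 * k))"
      by (simp only: sum_constant) (intro mult_right_mono, auto)
    also have "\<dots> = 1 / real n ^ (2 * k)"
    proof -
      have "real n ^ (5 * k) = real n ^ (3 * k) * real n ^ (2 * k)" by (simp flip: power_add)
      then show ?thesis using n by simp
    qed
    also have "\<dots> \<le> 1 / real n ^ 2"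
      using n k by (intro divide_left_mono power_increasing) auto
    finally show "(\<Sum>_\<in>{A. A \<subseteq> U \<and> card A = k} \<times> {B. B \<subseteq> V \<and> card B = n + 1 - 2 * k}.
        1 / real n ^ (5 * k)) \<le> 1 / real n ^ 2" .
  qed
  also have "\<dots> = real (n div 3) * (1 / real n ^ 2)" by simp
  also have "\<dots> \<le> real n * (1 / real n ^ 2)" by (intro mult_right_mono) auto
  also have "\<dots> = 1 / n" by (simp add: power2_eq_square)
  finally show "prob {\<omega> \<in> space M. \<not> expanding U V (E \<omega>)} \<le> 1 / n" unfolding eq .
qed

text \<open>The density is at least \<open>c\<close> on the interval from
  \<open>1 - \<delta>\<close> to 1, which therefore has mass at least \<open>c * \<delta>\<close>.
  The estimate \<open>1 - y \<le> exp (- y)\<close> gives a form that behaves well under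
  powers.\<close>

lemma
  assumes X: "distributed M lborel X (\<lambda>x. ennreal (g x))"
    and c: "0 \<le> c" "\<And>x. x \<in> {0..1} \<Longrightarrow> c \<le> g x" and g0: "\<And>x. x \<notin> {0..1} \<Longrightarrow> g x = 0"
  shows prob_density_less_le: "0 \<le> \<delta> \<Longrightarrow> \<delta> \<le> 1 \<Longrightarrow>
      prob {\<omega> \<in> space M. X \<omega> < 1 - \<delta>} \<le> exp (- (c * \<delta>))"
    and prob_density_gt_1: "prob {\<omega> \<in> space M. 1 < X \<omega>} = 0"
proof -
  have [measurable]: "X \<in> borel_measurable M"
    using distributed_measurable[OF X] by simp
  show "prob {\<omega> \<in> space M. X \<omega> < 1 - \<delta>} \<le> exp (- (c * \<delta>))" if \<delta>: "0 \<le> \<delta>" "\<delta> \<le> 1"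
  proof -
    have "ennreal (c * \<delta>) = (\<integral>\<^sup>+x. ennreal c * indicator {1 - \<delta>..1} x \<partial>lborel)"
      using \<delta> c by (simp add: nn_integral_cmult ennreal_mult)
    also have "\<dots> \<le> (\<integral>\<^sup>+x. ennreal (g x) * indicator {1 - \<delta>..1} x \<partial>lborel)"
      using \<delta> c(2) by (intro nn_integral_mono) (auto split: split_indicator intro!: ennreal_leI)
    also have "\<dots> = emeasure M (X -` {1 - \<delta>..1} \<inter> space M)"
      by (rule distributed_emeasure[OF X, symmetric]) simp
    finally have "c * \<delta> \<le> prob (X -` {1 - \<delta>..1} \<inter> space M)"
      using c \<delta> by (simp add: emeasure_eq_measure)
    also have "\<dots> \<le> prob (space M - {\<omega> \<in> space M. X \<omega> < 1 - \<delta>})"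
      by (intro finite_measure_mono) auto
    also have "\<dots> = 1 - prob {\<omega> \<in> space M. X \<omega> < 1 - \<delta>}" by (rule prob_compl) measurable
    finally have "prob {\<omega> \<in> space M. X \<omega> < 1 - \<delta>} \<le> 1 + - (c * \<delta>)" by simp
    also have "\<dots> \<le> exp (- (c * \<delta>))" by (rule exp_ge_add_one_self)
    finally show ?thesis .
  qed
  have "emeasure M (X -` {1<..} \<inter> space M) = (\<integral>\<^sup>+x. ennreal (g x) * indicator {1<..} x \<partial>lborel)"
    by (rule distributed_emeasure[OF X]) simp
  also have "\<dots> = (\<integral>\<^sup>+(x::real). 0 \<partial>lborel)"
    using g0 by (intro nn_integral_cong) (auto split: split_indicator)
  finally have "prob (X -` {1<..} \<inter> space M) = 0" by (simp add: emeasure_eq_measure)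
  moreover have "X -` {1<..} \<inter> space M = {\<omega> \<in> space M. 1 < X \<omega>}" by auto
  ultimately show "prob {\<omega> \<in> space M. 1 < X \<omega>} = 0" by simp
qed

text \<open>A union bound over three bad events: failure of expansion on either side, each of
  probability at most \<open>1 / n\<close>, and some value above 1, a null event.\<close>

lemma prob_workers_share_ge:
  fixes \<alpha> :: "'a \<Rightarrow> 'i \<Rightarrow> 'i \<Rightarrow> real"
  assumes fin: "finite F" "finite W" "F \<inter> W = {}" and card: "card F = n" "card W = n"
    and indep: "indep_vars (\<lambda>_. borel) (\<lambda>(f, w) \<omega>. \<alpha> \<omega> f w) (F \<times> W)"
    and distr: "\<And>f w. f \<in> F \<Longrightarrow> w \<in> W \<Longrightarrow>
      distributed M lborel (\<lambda>\<omega>. \<alpha> \<omega> f w) (\<lambda>x. ennreal (g x))"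
    and g: "0 < c" "\<And>x. x \<in> {0..1} \<Longrightarrow> c \<le> g x" "\<And>x. x \<notin> {0..1} \<Longrightarrow> g x = 0"
    and n: "9 \<le> n" and L: "n \<le> 2 ^ L"
    and \<delta>: "\<delta> = 15 / c * (ln n / n)" "\<delta> \<le> 1" "(2 * real L + 1) * \<delta> \<le> 1 / 2"
    and x: "4 * real L * \<delta> \<le> x"
  shows "1 - 2 / n \<le> prob {\<omega> \<in> space M. \<exists>\<mu> u v. firm_optimal_core_allocation F W (\<alpha> \<omega>) \<mu> u v \<and>
    workers_share F W (\<alpha> \<omega>) v \<le> x}" (is "_ \<le> prob ?Ev")
proof -
  have \<delta>0: "0 \<le> \<delta>" using \<delta>(1) g(1) n by simp
  have meas[measurable]: "(\<lambda>\<omega>. \<alpha> \<omega> f w) \<in> borel_measurable M" if "f \<in> F" "w \<in> W" for f w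
    using distributed_measurable[OF distr[OF that]] by simp
  \<comment> \<open>The choice of \<open>\<delta>\<close> makes \<open>c * \<delta>\<close> equal to
    \<open>15 * ln n / n\<close>.\<close>
  have q: "prob {\<omega> \<in> space M. \<alpha> \<omega> f w < 1 - \<delta>} \<le> exp (- (15 * ln n / n))"
    if "f \<in> F" "w \<in> W" for f w
    using prob_density_less_le[OF distr[OF that] _ g(2,3) \<delta>0 \<delta>(2)] g(1) by (simp add: \<delta>(1))
  let ?E1 = "{\<omega> \<in> space M. \<not> expanding F W (\<lambda>f w. 1 - \<delta> \<le> \<alpha> \<omega> f w)}"
  let ?E2 = "{\<omega> \<in> space M. \<not> expanding W F (\<lambda>w f. 1 - \<delta> \<le> \<alpha> \<omega> f w)}"
  let ?E3 = "\<Union>i\<in>F \<times> W. {\<omega> \<in> space M. 1 < \<alpha> \<omega> (fst i) (snd i)}"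
  have n1: "1 \<le> n" using n by simp
  have E1: "?E1 \<in> events" "prob ?E1 \<le> 1 / n"
  proof -
    have *: "{\<omega> \<in> space M. \<forall>x\<in>A. \<forall>y\<in>B. \<not> 1 - \<delta> \<le> \<alpha> \<omega> x y} \<in> events"
      "prob {\<omega> \<in> space M. \<forall>x\<in>A. \<forall>y\<in>B. \<not> 1 - \<delta> \<le> \<alpha> \<omega> x y} \<le>
        exp (- (15 * ln n / n)) ^ (card A * card B)"
      if "A \<subseteq> F" "B \<subseteq> W" "A \<noteq> {}" "B \<noteq> {}" for A B
      using prob_all_less_le[OF indep that(1,2) _ _ that(3,4) q] that fin
      by (auto simp: not_le intro: finite_subset)
    show "?E1 \<in> events" "prob ?E1 \<le> 1 / n"
      using prob_not_expanding_le[OF fin(1,2) card n1 *] by blast+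
  qed
  have E2: "?E2 \<in> events" "prob ?E2 \<le> 1 / n"
  proof -
    have *: "{\<omega> \<in> space M. \<forall>x\<in>A. \<forall>y\<in>B. \<not> 1 - \<delta> \<le> \<alpha> \<omega> y x} \<in> events"
      "prob {\<omega> \<in> space M. \<forall>x\<in>A. \<forall>y\<in>B. \<not> 1 - \<delta> \<le> \<alpha> \<omega> y x} \<le>
        exp (- (15 * ln n / n)) ^ (card A * card B)"
      if "A \<subseteq> W" "B \<subseteq> F" "A \<noteq> {}" "B \<noteq> {}" for A B
    proof -
      have "finite A" "finite B" using that fin finite_subset by blast+
      note le = prob_all_less_le[OF indep that(2,1) \<open>finite B\<close> \<open>finite A\<close> that(4,3) q]
      have eq: "{\<omega> \<in> space M. \<forall>x\<in>A. \<forall>y\<in>B. \<not> 1 - \<delta> \<le> \<alpha> \<omega> y x} =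
        {\<omega> \<in> space M. \<forall>f\<in>B. \<forall>w\<in>A. \<alpha> \<omega> f w < 1 - \<delta>}" by (auto simp: not_le)
      show "{\<omega> \<in> space M. \<forall>x\<in>A. \<forall>y\<in>B. \<not> 1 - \<delta> \<le> \<alpha> \<omega> y x} \<in> events"
        unfolding eq by (rule le(1))
      show "prob {\<omega> \<in> space M. \<forall>x\<in>A. \<forall>y\<in>B. \<not> 1 - \<delta> \<le> \<alpha> \<omega> y x} \<le>
        exp (- (15 * ln n / n)) ^ (card A * card B)"
        unfolding eq using le(2) by (simp add: mult.commute)
    qed
    show "?E2 \<in> events" "prob ?E2 \<le> 1 / n"
      using prob_not_expanding_le[OF fin(2,1) card(2,1) n1 *] by blast+
  qed
  have E3: "?E3 \<in> events" "prob ?E3 \<le> 0"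
  proof -
    have sub: "(\<lambda>i. {\<omega> \<in> space M. 1 < \<alpha> \<omega> (fst i) (snd i)}) ` (F \<times> W) \<subseteq> events" by auto
    then show "?E3 \<in> events" using fin by (intro sets.finite_UN) auto
    have "prob ?E3 \<le> (\<Sum>i\<in>F \<times> W. prob {\<omega> \<in> space M. 1 < \<alpha> \<omega> (fst i) (snd i)})"
      using fin by (intro finite_measure_subadditive_finite sub) auto
    also have "\<dots> = 0"
      using prob_density_gt_1[OF distr _ g(2,3)] g(1) by (intro sum.neutral) auto
    finally show "prob ?E3 \<le> 0" .
  qed
  have Ev: "?Ev \<in> events"
    using card by (intro sets_firm_optimal_share_le fin meas) auto
  have "space M - ?Ev \<subseteq> ?E1 \<union> (?E2 \<union> ?E3)"
  proof
    fix \<omega> assume \<omega>: "\<omega> \<in> space M - ?Ev"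
    show "\<omega> \<in> ?E1 \<union> (?E2 \<union> ?E3)"
    proof (rule ccontr)
      assume "\<not> ?thesis"
      then have exp: "expanding F W (\<lambda>f w. 1 - \<delta> \<le> \<alpha> \<omega> f w)"
          "expanding W F (\<lambda>w f. 1 - \<delta> \<le> \<alpha> \<omega> f w)"
        and le1: "\<And>f w. f \<in> F \<Longrightarrow> w \<in> W \<Longrightarrow> \<alpha> \<omega> f w \<le> 1"
        using \<omega> by force+
      interpret assignment_market F W "\<alpha> \<omega>" using fin by unfold_locales
      obtain m where m: "optimal_matching F W (\<alpha> \<omega>) m"
        using exists_optimal_matching[of F W "\<alpha> \<omega>"] fin card by auto
      have "sum (salary F W (\<alpha> \<omega>) m) W / matching_value F (\<alpha> \<omega>) m \<le> x"
        using expanding_imp_workers_share_le[OF card n le1 exp L \<delta>0 \<delta>(3) m] x by linarith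
      then show False using \<omega> exists_firm_optimal_workers_share_le_iff[OF m] by blast
    qed
  qed
  then have "prob (space M - ?Ev) \<le> prob (?E1 \<union> (?E2 \<union> ?E3))"
    using E1 E2 E3 by (intro finite_measure_mono) auto
  also have "\<dots> \<le> prob ?E1 + (prob ?E2 + prob ?E3)"
    using measure_Un_le[OF E1(1) sets.Un[OF E2(1) E3(1)]] measure_Un_le[OF E2(1) E3(1)] by linarith
  also have "\<dots> \<le> 2 / n" using E1 E2 E3 by simp
  finally show ?thesis using prob_compl[OF Ev] by simp
qed

end

section \<open>Constants and the asymptotic conclusion\<close>

theorem corollary7:
  fixes P :: "nat \<Rightarrow> 'a measure"
    and F W :: "nat \<Rightarrow> 'i set"
    and \<alpha> :: "nat \<Rightarrow> 'a \<Rightarrow> 'i \<Rightarrow> 'i \<Rightarrow> real"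
    and g :: "real \<Rightarrow> real"
  assumes "continuous_on {0..1} g"
    and "\<And>x. x \<in> {0..1} \<Longrightarrow> g x > 0"
    and "\<And>x. x \<notin> {0..1} \<Longrightarrow> g x = 0"
    and "\<And>n. n \<ge> 1 \<Longrightarrow> prob_space (P n)"
    and "\<And>n. n \<ge> 1 \<Longrightarrow> finite (F n) \<and> finite (W n) \<and> F n \<inter> W n = {}"
    and "\<And>n. n \<ge> 1 \<Longrightarrow> card (F n) = n \<and> card (W n) = n"
    and "\<And>n. n \<ge> 1 \<Longrightarrow>
           prob_space.indep_vars (P n) (\<lambda>_. borel) (\<lambda>(f, w) \<omega>. \<alpha> n \<omega> f w) (F n \<times> W n)"
    and "\<And>n f w. n \<ge> 1 \<Longrightarrow> f \<in> F n \<Longrightarrow> w \<in> W n \<Longrightarrow>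
           distributed (P n) lborel (\<lambda>\<omega>. \<alpha> n \<omega> f w) (\<lambda>x. ennreal (g x))"
  shows "\<exists>C::real. (\<lambda>n. 1 - measure (P n) {\<omega> \<in> space (P n).
             \<exists>\<mu> u v. firm_optimal_core_allocation (F n) (W n) (\<alpha> n \<omega>) \<mu> u v \<and>
               workers_share (F n) (W n) (\<alpha> n \<omega>) v \<le> C * ((ln (real n))\<^sup>2 / real n)})
           \<in> O(\<lambda>n. 1 / real n)"
proof -
  \<comment> \<open>By compactness the density attains its minimum on the unit interval; this
    positive value is the lower bound \<open>c\<close>.\<close>
  obtain x0 where x0: "x0 \<in> {0..1::real}" "\<And>x. x \<in> {0..1} \<Longrightarrow> g x0 \<le> g x"
    using continuous_attains_inf[of "{0..1}" g] assms(1) by fastforce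
  define c where "c = g x0"
  have c: "0 < c" using assms(2) x0 by (simp add: c_def)
  define K where "K = 15 / c"
  have K: "0 < K" using c by (simp add: K_def)
  have ev1: "eventually (\<lambda>n. K * (ln (real n) / real n) \<le> 1) sequentially"
    using K by real_asymp
  \<comment> \<open>The factor 6 anticipates \<open>real L \<le> 3 * ln n\<close>, proved
    below.\<close>
  have ev2: "eventually (\<lambda>n. (6 * ln (real n) + 1) * (K * (ln (real n) / real n)) \<le> 1 / 2) sequentially"
    using K by real_asymp
  \<comment> \<open>The constant 12 is 4 from the share bound \<open>4 * real L * \<delta>\<close>
    times 3 from the bound on \<open>L\<close>.\<close>
  have "eventually (\<lambda>n. norm (1 - measure (P n) {\<omega> \<in> space (P n).
             \<exists>\<mu> u v. firm_optimal_core_allocation (F n) (W n) (\<alpha> n \<omega>) \<mu> u v \<and>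
               workers_share (F n) (W n) (\<alpha> n \<omega>) v \<le> 12 * K * ((ln (real n))\<^sup>2 / real n)})
           \<le> 2 * norm (1 / real n)) sequentially"
    using ev1 ev2 eventually_ge_at_top[of 9]
  proof eventually_elim
    case (elim n)
    then have n: "1 \<le> n" "9 \<le> n" by auto
    interpret prob_space "P n" using assms(4) n by blast
    define \<delta> where "\<delta> = K * (ln (real n) / real n)"
    have \<delta>0: "0 \<le> \<delta>" using K n by (simp add: \<delta>_def)
    define L where "L = nat \<lceil>log 2 (real n)\<rceil>"
    have "log 2 (real n) \<le> real L" unfolding L_def by linarith
    then have "real n \<le> 2 powr real L" using n by (simp add: log_le_iff)
    then have "real n \<le> real (2 ^ L)" by (simp add: powr_realpow)
    then have nL: "n \<le> 2 ^ L" by (simp only: of_nat_le_iff)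
    \<comment> \<open>From \<open>ln n \<ge> 1\<close>, the rounding error 1 in \<open>L\<close> is
      absorbed into a third \<open>ln n\<close>.\<close>
    have "exp 1 \<le> real n" using exp_le n by linarith
    then have ln1: "1 \<le> ln (real n)" using n by (simp add: ln_ge_iff)
    have "0 \<le> log 2 (real n)" using n by simp
    then have "real L \<le> log 2 (real n) + 1" unfolding L_def by linarith
    also have "log 2 (real n) \<le> 2 * ln (real n)"
    proof -
      have "(1::real) / 2 \<le> ln 2" using ln2_ge_two_thirds by linarith
      then have "ln (real n) * (1 / 2) \<le> ln (real n) * ln 2" using ln1 by (intro mult_left_mono) auto
      then show ?thesis by (simp add: log_def field_simps)
    qed
    finally have L3: "real L \<le> 3 * ln (real n)" using ln1 by simp
    have "(2 * real L + 1) * \<delta> \<le> (6 * ln (real n) + 1) * \<delta>"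
      using L3 \<delta>0 by (intro mult_right_mono) auto
    also have "\<dots> \<le> 1 / 2" using elim(2) by (simp only: \<delta>_def)
    finally have \<delta>2: "(2 * real L + 1) * \<delta> \<le> 1 / 2" .
    have "4 * real L * \<delta> \<le> 12 * ln (real n) * \<delta>" using L3 \<delta>0 by (intro mult_right_mono) auto
    also have "\<dots> = 12 * K * ((ln (real n))\<^sup>2 / real n)"
      by (simp add: \<delta>_def power2_eq_square)
    finally have x: "4 * real L * \<delta> \<le> 12 * K * ((ln (real n))\<^sup>2 / real n)" .
    have "1 - 2 / real n \<le> prob {\<omega> \<in> space (P n).
             \<exists>\<mu> u v. firm_optimal_core_allocation (F n) (W n) (\<alpha> n \<omega>) \<mu> u v \<and>
               workers_share (F n) (W n) (\<alpha> n \<omega>) v \<le> 12 * K * ((ln (real n))\<^sup>2 / real n)}"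
      by (rule prob_workers_share_ge[where g = g and c = c and \<delta> = \<delta> and L = L])
        (use assms(3,5-8) n c x0 nL \<delta>2 x elim(1) in \<open>auto simp: c_def \<delta>_def K_def\<close>)
    then show ?case by simp
  qed
  then show ?thesis by (intro exI[of _ "12 * K"] bigoI)
qed

end
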